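(* Let $\{g_t\}$ and $\{m_t\}$ be sequences of random vectors in $\mathbb{X}_*$ and let $\{d_t\}$ be defined recursively by $$d_t=g_t+(1-\gamma_t)(d_{t-1}-m_t).$$ Assume that $\|\cdot\|_*^2$ is $M$-strongly smooth (with respect to $\|\cdot\|_*$), and that $\mathbb{E}[g_t\mid d_{t-1}]=\mu_t$ and $\mathbb{E}[m_t\mid d_{t-1}]=\mu_{t-1}$. Define $\epsilon_t=d_t-\mu_t$. Set $\gamma_t=\frac{2}{1+\tau_t}$ and $\tau_t=(1+t\gamma)^{2/3}$ with $0<\gamma\le1$. Then $$\mathbb{E}\Big[\sum_{t=1}^T\|\epsilon_t\|_*^2\Big]\le\sum_{t=1}^T\frac{6M}{5\tau_t}\mathbb{E}[\|g_t-\mu_t\|_*^2]+\sum_{t=1}^T\frac{3M(\tau_t-1)^2}{5\tau_t}\mathbb{E}[\|g_t-m_t\|_*^2].$$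
   Context: $(\mathbb{X},\|\cdot\|)$ is a finite-dimensional real normed space with dual $(\mathbb{X}_*,\|\cdot\|_* )$. $\|\cdot\|_*^2$ is $M$-strongly smooth if $\|x+y\|_*^2\le\|x\|_*^2+\langle g_x,y\rangle+\frac M2\|y\|_*^2$ for all $x,y\in\mathbb{X}_*$ and all subgradients $g_x\in\partial\|\cdot\|_*^2(x)$. The index $t$ runs over $1,\dots,T$, where $T\ge1$ is the number of steps; $d_0$ is the initial vector of the recursion and $\mu_0=\mathbb{E}[m_1\mid d_0]$.
   Formalization: The formal theorem additionally assumes that the initial error vanishes, ε_0 = d_0 − μ_0 = 0 almost surely (e.g. d_0 = m_1); without it the claim fails, e.g. for g_1 = m_1 = 0, d_0 = 1, T = 1 on the real line. *)

theory Defs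
  imports "HOL-Probability.Probability"
begin

class finite_dim_normed_vector = real_normed_vector +
  assumes finite_spanning: "\<exists>B. finite B \<and> (\<forall>x. \<exists>c. x = (\<Sum>b\<in>B. c b *\<^sub>R b))"

instance euclidean_space \<subseteq> finite_dim_normed_vector
proof
  have "\<exists>c. x = (\<Sum>b\<in>Basis. c b *\<^sub>R b)" for x :: 'a
    using euclidean_representation[of x] by metis
  then show "\<exists>B. finite B \<and> (\<forall>x::'a. \<exists>c. x = (\<Sum>b\<in>B. c b *\<^sub>R b))"
    by (intro exI[of _ Basis]) simp
qed

instance finite_dim_normed_vector \<subseteq> second_countable_topology
proof
  obtain B :: "'a set" where B: "finite B" "\<And>x. \<exists>c. x = (\<Sum>b\<in>B. c b *\<^sub>R b)"
    using finite_spanning by blast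
  define D where "D = (\<lambda>q. \<Sum>b\<in>B. q b *\<^sub>R b) ` (B \<rightarrow>\<^sub>E \<rat>)"
  have cD: "countable D"
    unfolding D_def using B(1) by (intro countable_image countable_PiE) (auto simp: countable_rat)
  have dense: "\<exists>y\<in>D. dist y x < e" if e: "e > 0" for x :: 'a and e :: real
  proof -
    obtain c where c: "x = (\<Sum>b\<in>B. c b *\<^sub>R b)" using B(2) by blast
    define K where "K = 1 + (\<Sum>b\<in>B. norm b)"
    have K: "K > 0" unfolding K_def by (simp add: add_pos_nonneg sum_nonneg)
    have "\<forall>b. \<exists>r. r \<in> \<rat> \<and> \<bar>r - c b\<bar> < e / K"
    proof
      fix b
      have "c b < c b + e / K" using e K by simp
      from Rats_dense_in_real[OF this]
      obtain r where "r \<in> \<rat>" "c b < r" "r < c b + e / K" by blast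
      then have "r \<in> \<rat> \<and> \<bar>r - c b\<bar> < e / K" by simp
      then show "\<exists>r. r \<in> \<rat> \<and> \<bar>r - c b\<bar> < e / K" by (rule exI)
    qed
    from choice[OF this] obtain q where q: "\<And>b. q b \<in> \<rat>" "\<And>b. \<bar>q b - c b\<bar> < e / K"
      by blast
    define y where "y = (\<Sum>b\<in>B. restrict q B b *\<^sub>R b)"
    have "y \<in> D" unfolding y_def D_def using q(1) by (intro imageI) auto
    moreover have "dist y x < e"
    proof -
      have "y - x = (\<Sum>b\<in>B. (q b - c b) *\<^sub>R b)"
        unfolding y_def c by (simp add: sum_subtractf scaleR_diff_left)
      then have "norm (y - x) \<le> (\<Sum>b\<in>B. \<bar>q b - c b\<bar> * norm b)"
        using norm_sum[of "\<lambda>b. (q b - c b) *\<^sub>R b" B] by simp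
      also have "\<dots> \<le> (\<Sum>b\<in>B. e / K * norm b)"
        using q(2) by (intro sum_mono mult_right_mono) (auto intro: less_imp_le)
      also have "\<dots> = e / K * (K - 1)" by (simp add: K_def sum_distrib_left)
      also have "\<dots> < e" using e K by (simp add: field_simps)
      finally show ?thesis by (simp add: dist_norm)
    qed
    ultimately show ?thesis by blast
  qed
  define \<B> where "\<B> = (\<lambda>(y, n). ball y (inverse (real (Suc n)))) ` (D \<times> (UNIV :: nat set))"
  have cB: "countable \<B>" unfolding \<B>_def using cD by (intro countable_image countable_SIGMA) auto
  have tb: "topological_basis \<B>"
  proof (rule topological_basisI)
    fix U assume "U \<in> \<B>" then show "open U" unfolding \<B>_def by auto
  next
    fix U and x :: 'a assume "open U" "x \<in> U"
    then obtain e where e: "e > 0" "ball x e \<subseteq> U" by (meson openE)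
    obtain n where n: "inverse (real (Suc n)) < e / 2"
      using reals_Archimedean[of "e / 2"] e(1) by auto
    obtain y where y: "y \<in> D" "dist y x < inverse (real (Suc n))"
      using dense[of "inverse (real (Suc n))" x] by auto
    have "ball y (inverse (real (Suc n))) \<subseteq> ball x e"
    proof
      fix z assume "z \<in> ball y (inverse (real (Suc n)))"
      then have "dist y z < inverse (real (Suc n))" by simp
      then have "dist x z < e" using dist_triangle[of x z y] y(2) n by (simp add: dist_commute)
      then show "z \<in> ball x e" by simp
    qed
    then show "\<exists>V\<in>\<B>. x \<in> V \<and> V \<subseteq> U"
      using y e(2) unfolding \<B>_def by (intro bexI[of _ "ball y (inverse (real (Suc n)))"]) auto
  qed
  show "\<exists>B::'a set set. countable B \<and> open = generate_topology B"
    using cB topological_basis_imp_subbasis[OF tb] by blast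
qed

lemma separating_functionals_imp_finite_spanning:
  fixes l :: "'i \<Rightarrow> 'v::real_vector \<Rightarrow> real"
  assumes "finite I" "\<And>i. linear (l i)" "subspace S"
    and "\<And>x. x \<in> S \<Longrightarrow> (\<And>i. i \<in> I \<Longrightarrow> l i x = 0) \<Longrightarrow> x = 0"
  shows "\<exists>C. finite C \<and> S \<subseteq> span C"
  using assms(1,3,4)
proof (induction I arbitrary: S rule: finite_induct)
  case empty
  then show ?case by (intro exI[of _ "{}"]) auto
next
  case (insert i I)
  interpret li: linear "l i" by (rule assms(2))
  define S0 where "S0 = {x \<in> S. l i x = 0}"
  have "subspace S0"
    using insert.prems(1) unfolding S0_def subspace_def by (auto simp: li.add li.scale)
  moreover have "x = 0" if "x \<in> S0" "\<And>j. j \<in> I \<Longrightarrow> l j x = 0" for x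
    using that insert.prems(2)[of x] unfolding S0_def by auto
  ultimately obtain C where C: "finite C" "S0 \<subseteq> span C" using insert.IH by blast
  show ?case
  proof (cases "\<exists>p\<in>S. l i p \<noteq> 0")
    case False
    then show ?thesis using C unfolding S0_def by (intro exI[of _ C]) auto
  next
    case True
    then obtain p where p: "p \<in> S" "l i p \<noteq> 0" by blast
    have "x \<in> span (insert p C)" if "x \<in> S" for x
    proof -
      define k where "k = l i x / l i p"
      have "x - k *\<^sub>R p \<in> S0"
        using that p insert.prems(1) unfolding S0_def k_def
        by (auto simp: li.diff li.scale subspace_diff subspace_scale)
      then have "x - k *\<^sub>R p \<in> span C" using C by blast
      then show ?thesis by (auto simp: span_insert)
    qed
    then show ?thesis using C(1) by (intro exI[of _ "insert p C"]) auto
  qed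
qed

instance blinfun :: (finite_dim_normed_vector, euclidean_space) finite_dim_normed_vector
proof
  obtain B :: "'a set" where B: "finite B" "\<And>x. \<exists>c. x = (\<Sum>b\<in>B. c b *\<^sub>R b)"
    using finite_spanning by blast
  define l :: "'a \<times> 'b \<Rightarrow> ('a \<Rightarrow>\<^sub>L 'b) \<Rightarrow> real" where "l = (\<lambda>(b, j) f. blinfun_apply f b \<bullet> j)"
  have "\<exists>C. finite C \<and> (UNIV :: ('a \<Rightarrow>\<^sub>L 'b) set) \<subseteq> span C"
  proof (rule separating_functionals_imp_finite_spanning[where I = "B \<times> Basis" and l = l])
    show "finite (B \<times> (Basis :: 'b set))" using B(1) by simp
    show "linear (l i)" for i
    proof -
      obtain b j where "i = (b, j)" by (cases i)
      then show ?thesis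
        by (intro linearI)
          (simp_all add: l_def plus_blinfun.rep_eq scaleR_blinfun.rep_eq inner_add_left)
    qed
    show "subspace (UNIV :: ('a \<Rightarrow>\<^sub>L 'b) set)" by simp
    fix f :: "'a \<Rightarrow>\<^sub>L 'b"
    assume 0: "\<And>i. i \<in> B \<times> Basis \<Longrightarrow> l i f = 0"
    have fb: "blinfun_apply f b = 0" if "b \<in> B" for b
      using 0 that by (auto simp: l_def euclidean_eq_iff[of _ "0 :: 'b"])
    show "f = 0"
    proof (rule blinfun_eqI)
      fix x
      obtain c where "x = (\<Sum>b\<in>B. c b *\<^sub>R b)" using B(2) by blast
      then show "blinfun_apply f x = blinfun_apply 0 x"
        using fb by (simp add: blinfun.sum_right blinfun.scaleR_right)
    qed
  qed
  then obtain C :: "('a \<Rightarrow>\<^sub>L 'b) set" where C: "finite C" "span C = UNIV" by blast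
  then have "\<exists>c. x = (\<Sum>b\<in>C. c b *\<^sub>R b)" for x
    using span_finite[OF C(1)] by auto
  then show "\<exists>C. finite C \<and> (\<forall>x::'a \<Rightarrow>\<^sub>L 'b. \<exists>c. x = (\<Sum>b\<in>C. c b *\<^sub>R b))"
    using C(1) by blast
qed

text \<open>
  For a space \<open>\<bbbX>\<close> of this class the dual \<open>\<bbbX>\<^sub>*\<close> is the type \<open>'a \<Rightarrow>\<^sub>L real\<close>, whose norm is the
  dual norm. The instances above provide what Bochner integration over it requires.
\<close>

definition subdifferential :: "('v::real_normed_vector \<Rightarrow> real) \<Rightarrow> 'v \<Rightarrow> ('v \<Rightarrow>\<^sub>L real) set"
  where "subdifferential f x = {p. \<forall>y. f x + blinfun_apply p (y - x) \<le> f y}"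

definition strongly_smooth :: "real \<Rightarrow> ('v::real_normed_vector \<Rightarrow> real) \<Rightarrow> bool"
  where "strongly_smooth M f \<longleftrightarrow>
    (\<forall>x y. \<forall>p\<in>subdifferential f x. f (x + y) \<le> f x + blinfun_apply p y + M / 2 * (norm y)\<^sup>2)"

definition sigma_of :: "'w measure \<Rightarrow> ('w \<Rightarrow> 'v::topological_space) \<Rightarrow> 'w measure"
  where "sigma_of P X = vimage_algebra (space P) X borel"

text \<open>
  \<open>has_cond_exp P F X Y\<close> states \<open>E[X | F] = Y\<close> almost surely. \<open>Y\<close> itself only has to agree
  almost surely with an \<open>F\<close>-measurable function, so that one random vector can be the conditional
  expectation with respect to two different sub-\<open>\<sigma>\<close>-algebras.
\<close>

definition has_cond_exp ::
    "'w measure \<Rightarrow> 'w measure \<Rightarrow> ('w \<Rightarrow> 'v::{banach, second_countable_topology}) \<Rightarrow> ('w \<Rightarrow> 'v) \<Rightarrow> bool"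
  where "has_cond_exp P F X Y \<longleftrightarrow>
    subalgebra P F \<and> integrable P X \<and> integrable P Y \<and>
    (\<exists>Z\<in>borel_measurable F. AE \<omega> in P. Y \<omega> = Z \<omega>) \<and>
    (\<forall>A\<in>sets F. (LINT \<omega>:A|P. X \<omega>) = (LINT \<omega>:A|P. Y \<omega>))"

end

theory Submission
  imports Defs
begin

text \<open>
  Subtracting \<open>\<mu>\<^sub>t\<close> from the recursion gives \<open>\<epsilon>\<^sub>t = X + (Y - E[Y | d\<^sub>t\<^sub>-\<^sub>1])\<close> with
  \<open>X = (1 - \<gamma>\<^sub>t) \<epsilon>\<^sub>t\<^sub>-\<^sub>1\<close> and \<open>Y = \<gamma>\<^sub>t (g\<^sub>t - \<mu>\<^sub>t) + (1 - \<gamma>\<^sub>t) (g\<^sub>t - m\<^sub>t)\<close>. In a Hilbert space \<open>X\<close> and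
  the centred noise are orthogonal, and centring does not increase the second moment. For a general
  norm neither is available, and centring can multiply a second moment by almost \<open>4\<close>. Strong
  smoothness still gives, with the same constants as orthogonality would,
  \[ E \|X + Y - E[Y | F]\|^2 \le E \|X\|^2 + \frac M2 E \|Y\|^2 . \]
  The point is to expand the square not at \<open>X\<close> but at \<open>Z = X - E[Y | F]\<close>. With \<open>p\<close> a subgradient at
  \<open>Z\<close>, smoothness bounds \<open>\<parallel>Z + Y\<parallel>\<^sup>2\<close> by \<open>\<parallel>Z\<parallel>\<^sup>2 + p(Y) + M/2 \<parallel>Y\<parallel>\<^sup>2\<close>, the subgradient inequality
  bounds \<open>\<parallel>Z\<parallel>\<^sup>2 + p(E[Y | F])\<close> by \<open>\<parallel>X\<parallel>\<^sup>2\<close>, and what is left, \<open>p(Y - E[Y | F])\<close>, has mean zero because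
  \<open>p\<close> depends only on the \<open>F\<close>-measurable \<open>Z\<close>. These steps are \<open>strongly_smooth_shifted_bound\<close>,
  \<open>integral_blinfun_simple_cond_centred\<close> and \<open>centred_second_moment_le\<close>. Strong smoothness speaks
  about subgradients without asserting that there are any; for a dual norm in finite dimension they
  come from vectors at which a functional attains its norm
  (\<open>subdifferential_dual_norm_squared_nonempty\<close>).

  Splitting \<open>\<parallel>Y\<parallel>\<^sup>2\<close> by \<open>(x + y)\<^sup>2 \<le> 2 x\<^sup>2 + 2 y\<^sup>2\<close> yields
  \[ E \|\epsilon_t\|^2 \le (1-\gamma_t)^2 E \|\epsilon_{t-1}\|^2
      + M \gamma_t^2 E \|g_t-\mu_t\|^2 + M (1-\gamma_t)^2 E \|g_t-m_t\|^2 . \]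
  This recursion is summed with the weights \<open>w\<^sub>t = 3 (1 + \<tau>\<^sub>t)\<^sup>2 / (10 \<tau>\<^sub>t)\<close>, which turn the coefficient
  \<open>M \<gamma>\<^sub>t\<^sup>2\<close> into exactly \<open>6 M / (5 \<tau>\<^sub>t)\<close>. The sum telescopes because \<open>w\<^sub>t - w\<^sub>t\<^sub>+\<^sub>1 (1 - \<gamma>\<^sub>t\<^sub>+\<^sub>1)\<^sup>2 \<ge> 1\<close>,
  and this reduces to \<open>\<tau>\<^sub>t\<^sub>+\<^sub>1 - \<tau>\<^sub>t \<le> 2/3\<close>, which holds for \<open>\<tau>\<^sub>t = (1 + t \<gamma>)\<^bsup>2/3\<^esup>\<close> with \<open>\<gamma> \<le> 1\<close>.

  All second moments may be infinite, so the recursion is proved and summed in the extended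
  nonnegative reals.
\<close>

section \<open>Subgradients of the squared dual norm\<close>

lemma bounded_seqs_common_convergent_subseq:
  fixes u :: "'i \<Rightarrow> nat \<Rightarrow> real"
  assumes "finite I" "\<And>i. i \<in> I \<Longrightarrow> bounded (range (u i))"
  shows "\<exists>r. strict_mono r \<and> (\<forall>i\<in>I. convergent (u i \<circ> r))"
  using assms
proof (induction I rule: finite_induct)
  case empty
  then show ?case by (auto intro: exI[of _ id] strict_mono_id)
next
  case (insert i I)
  then obtain r where r: "strict_mono r" "\<forall>j\<in>I. convergent (u j \<circ> r)"
    by (metis insertI2)
  have "bounded (range (u i \<circ> r))"
    using insert.prems[of i] by (rule bounded_subset) auto
  then obtain l s where s: "strict_mono s" "(u i \<circ> r \<circ> s) \<longlonglongrightarrow> l"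
    using bounded_imp_convergent_subsequence by blast
  have "convergent (u j \<circ> (r \<circ> s))" if "j \<in> insert i I" for j
    using that r(2) s convergent_subseq_convergent[of "u j \<circ> r" s]
    by (auto simp: o_assoc convergent_def)
  then show ?case
    using strict_mono_o[OF r(1) s(1)] by blast
qed

text \<open>
  The dual norm is a supremum over the unit ball, and \<open>- x\<close> lies in the ball whenever \<open>x\<close> does, so
  the absolute value can be dropped.
\<close>

lemma blinfun_almost_attains_norm:
  fixes f :: "'a::real_normed_vector \<Rightarrow>\<^sub>L real"
  assumes "0 < \<delta>"
  shows "\<exists>x. norm x \<le> 1 \<and> norm f - \<delta> < blinfun_apply f x"
proof (rule ccontr)
  assume "\<not> ?thesis"
  then have le: "blinfun_apply f x \<le> norm f - \<delta>" if "norm x \<le> 1" for x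
    using that by (meson not_le)
  have nonneg: "0 \<le> norm f - \<delta>"
    using le[of 0] by simp
  have "norm f \<le> norm f - \<delta>"
  proof (rule norm_blinfun_bound[OF nonneg])
    fix x
    show "norm (blinfun_apply f x) \<le> (norm f - \<delta>) * norm x"
    proof (cases "x = 0")
      case False
      have "blinfun_apply f (x /\<^sub>R norm x) \<le> norm f - \<delta>"
        "blinfun_apply f (- x /\<^sub>R norm x) \<le> norm f - \<delta>"
        using False by (auto intro!: le)
      then show ?thesis
        using False by (auto simp: blinfun.scaleR_right blinfun.minus_right field_simps abs_le_iff)
    qed simp
  qed
  then show False using assms by simp
qed

text \<open>
  Here is a substitute for the Hahn-Banach theorem on the dual. Evaluation at a vector of the unit
  ball is a functional of norm at most \<open>1\<close>, and evaluations at almost norming vectors nearly have the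
  value \<open>norm f\<close> at \<open>f\<close>. As the dual is finitely spanned, a subsequence of these evaluations converges
  on a spanning set, hence pointwise, and its limit is exactly norming.
\<close>

lemma dual_norming_functional:
  fixes f :: "'a::finite_dim_normed_vector \<Rightarrow>\<^sub>L real"
  obtains \<phi> :: "('a \<Rightarrow>\<^sub>L real) \<Rightarrow>\<^sub>L real"
  where "\<And>h. blinfun_apply \<phi> h \<le> norm h" "blinfun_apply \<phi> f = norm f"
proof -
  have "\<exists>x. norm x \<le> 1 \<and> norm f - inverse (real (Suc n)) < blinfun_apply f x" for n
    by (rule blinfun_almost_attains_norm) simp
  then obtain x where x: "\<And>n. norm (x n) \<le> 1"
      "\<And>n. norm f - inverse (real (Suc n)) < blinfun_apply f (x n)"
    by metis
  have bnd: "\<bar>blinfun_apply h (x n)\<bar> \<le> norm h" for h :: "'a \<Rightarrow>\<^sub>L real" and n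
    using norm_blinfun[of h "x n"] x(1)[of n] mult_left_mono[of "norm (x n)" 1 "norm h"] by simp
  obtain B :: "('a \<Rightarrow>\<^sub>L real) set" where B: "finite B" "\<And>h. \<exists>c. h = (\<Sum>b\<in>B. c b *\<^sub>R b)"
    using finite_spanning by blast
  have "bounded (range (\<lambda>n. blinfun_apply h (x n)))" for h :: "'a \<Rightarrow>\<^sub>L real"
    using bnd[of h] by (intro boundedI[of _ "norm h"]) auto
  then obtain r where r: "strict_mono r" "\<And>b. b \<in> B \<Longrightarrow> convergent ((\<lambda>n. blinfun_apply b (x n)) \<circ> r)"
    using bounded_seqs_common_convergent_subseq[OF B(1), of "\<lambda>b n. blinfun_apply b (x n)"]
    by blast
  have conv: "convergent (\<lambda>n. blinfun_apply h (x (r n)))" for h :: "'a \<Rightarrow>\<^sub>L real"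
  proof -
    obtain c where c: "h = (\<Sum>b\<in>B. c b *\<^sub>R b)" using B(2) by blast
    have "convergent (\<lambda>n. \<Sum>b\<in>B. c b * blinfun_apply b (x (r n)))"
      using r(2) by (intro convergent_sum) (auto intro!: convergent_mult simp: comp_def convergent_const)
    then show ?thesis
      by (simp add: c blinfun.sum_left blinfun.scaleR_left)
  qed
  define L where "L = (\<lambda>h :: 'a \<Rightarrow>\<^sub>L real. lim (\<lambda>n. blinfun_apply h (x (r n))))"
  have L: "(\<lambda>n. blinfun_apply h (x (r n))) \<longlonglongrightarrow> L h" for h
    using conv[of h] by (simp add: L_def convergent_LIMSEQ_iff)
  have "bounded_linear L"
  proof (rule bounded_linear_intro[where K = 1])
    show "L (h + k) = L h + L k" for h k
      using LIMSEQ_unique[OF L[of "h + k"]] tendsto_add[OF L[of h] L[of k]]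
      by (simp add: blinfun.add_left)
    show "L (c *\<^sub>R h) = c *\<^sub>R L h" for c h
      using LIMSEQ_unique[OF L[of "c *\<^sub>R h"]] tendsto_mult_left[OF L[of h], of c]
      by (simp add: blinfun.scaleR_left)
    show "norm (L h) \<le> norm h * 1" for h
      using LIMSEQ_le_const2[OF tendsto_rabs[OF L[of h]], of "norm h"] bnd by auto
  qed
  then have app: "blinfun_apply (Blinfun L) = L" by (rule bounded_linear_Blinfun_apply)
  have "L h \<le> norm h" for h
    using LIMSEQ_le_const2[OF L[of h], of "norm h"] bnd by (auto simp: abs_le_iff)
  moreover have "norm f \<le> L f"
  proof -
    have "(\<lambda>n. norm f - inverse (real (Suc (r n)))) \<longlonglongrightarrow> norm f - 0"
      using LIMSEQ_subseq_LIMSEQ[OF LIMSEQ_inverse_real_of_nat r(1)]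
      by (intro tendsto_diff tendsto_const) (simp add: comp_def)
    then show ?thesis
      using LIMSEQ_le[OF _ L[of f], of _ "norm f"] x(2) by (auto intro: less_imp_le)
  qed
  ultimately show thesis
    using that[of "Blinfun L"] app by (metis order_antisym)
qed

text \<open>
  If \<open>\<phi>\<close> norms \<open>f\<close>, then \<open>2 \<parallel>f\<parallel> \<phi>\<close> is a subgradient of the squared norm at \<open>f\<close>: the subgradient
  inequality at \<open>h\<close> follows from \<open>2 \<parallel>f\<parallel> \<parallel>h\<parallel> \<le> \<parallel>f\<parallel>\<^sup>2 + \<parallel>h\<parallel>\<^sup>2\<close>.
\<close>

lemma subdifferential_dual_norm_squared_nonempty:
  fixes f :: "'a::finite_dim_normed_vector \<Rightarrow>\<^sub>L real"
  shows "subdifferential (\<lambda>x. (norm x)\<^sup>2) f \<noteq> {}"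
proof -
  obtain \<phi> :: "('a \<Rightarrow>\<^sub>L real) \<Rightarrow>\<^sub>L real" where \<phi>: "\<And>h. blinfun_apply \<phi> h \<le> norm h" "blinfun_apply \<phi> f = norm f"
    using dual_norming_functional by blast
  have "(norm f)\<^sup>2 + blinfun_apply ((2 * norm f) *\<^sub>R \<phi>) (h - f) \<le> (norm h)\<^sup>2" for h
  proof -
    have "2 * norm f * blinfun_apply \<phi> h \<le> 2 * norm f * norm h"
      using \<phi>(1) by (intro mult_left_mono) auto
    moreover have "2 * norm f * norm h \<le> (norm f)\<^sup>2 + (norm h)\<^sup>2"
      by (rule sum_squares_bound)
    ultimately show ?thesis
      by (simp add: blinfun.scaleR_left blinfun.diff_right \<phi>(2) algebra_simps power2_eq_square)
  qed
  then show ?thesis unfolding subdifferential_def by blast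
qed

section \<open>Second moments under conditional centring\<close>

text \<open>
  At the origin \<open>0\<close> is a subgradient, so that smoothness reads \<open>\<parallel>x\<parallel>\<^sup>2 \<le> M/2 \<parallel>x\<parallel>\<^sup>2\<close>. In particular \<open>M\<close>
  is positive unless the space is trivial.
\<close>

lemma strongly_smooth_norm_squared_modulus:
  fixes x :: "'v::real_normed_vector"
  assumes "strongly_smooth M (\<lambda>x :: 'v. (norm x)\<^sup>2)" "x \<noteq> 0"
  shows "2 \<le> M"
proof -
  have "0 \<in> subdifferential (\<lambda>x :: 'v. (norm x)\<^sup>2) 0"
    by (simp add: subdifferential_def)
  then have "(norm x)\<^sup>2 \<le> M / 2 * (norm x)\<^sup>2"
    using assms(1) unfolding strongly_smooth_def by fastforce
  then show ?thesis using assms(2) by simp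
qed

text \<open>
  The pointwise form of the centring inequality, with \<open>v\<close> in the role of the conditional mean of \<open>y\<close>:
  smoothness is applied in the direction \<open>y\<close> and the subgradient inequality in the direction \<open>v\<close>,
  both at \<open>z\<close>, and the two terms combine to \<open>p (y - v)\<close>, which averages out.
\<close>

lemma strongly_smooth_shifted_bound:
  assumes "strongly_smooth M f" "p \<in> subdifferential f z"
  shows "f (z + y) \<le> f (z + v) + blinfun_apply p (y - v) + M / 2 * (norm y)\<^sup>2"
proof -
  have "f z + blinfun_apply p v \<le> f (z + v)"
    using assms(2) unfolding subdifferential_def
    by (metis (mono_tags, lifting) add_diff_cancel_left' mem_Collect_eq)
  moreover have "f (z + y) \<le> f z + blinfun_apply p y + M / 2 * (norm y)\<^sup>2"
    using assms unfolding strongly_smooth_def by blast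
  ultimately show ?thesis by (simp add: blinfun.diff_right)
qed

lemma has_cond_expD:
  assumes "has_cond_exp P F X Y"
  shows "subalgebra P F" "integrable P X" "integrable P Y"
    and "\<exists>Z\<in>borel_measurable F. AE \<omega> in P. Y \<omega> = Z \<omega>"
    and "\<And>A. A \<in> sets F \<Longrightarrow> (LINT \<omega>:A|P. X \<omega>) = (LINT \<omega>:A|P. Y \<omega>)"
  using assms unfolding has_cond_exp_def by blast+

text \<open>
  On each level set of \<open>S\<close> the functional \<open>G (S \<omega>)\<close> is constant and can be pulled out of the
  integral of \<open>W\<close>, which vanishes there. \<open>S\<close> takes finitely many values, and this is what allows \<open>G\<close>
  to be an arbitrary choice of subgradients.
\<close>

lemma integral_blinfun_simple_cond_centred:
  fixes W :: "'w \<Rightarrow> 'v::{banach, second_countable_topology}"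
    and G :: "'z \<Rightarrow> ('v \<Rightarrow>\<^sub>L real)"
  assumes sub: "subalgebra P F" and W: "integrable P W"
    and cond: "\<And>A. A \<in> sets F \<Longrightarrow> (LINT \<omega>:A|P. W \<omega>) = 0"
    and S: "simple_function F S" and A: "A \<in> sets F"
  shows "integrable P (\<lambda>\<omega>. indicator A \<omega> * blinfun_apply (G (S \<omega>)) (W \<omega>))"
    and "(\<integral>\<omega>. indicator A \<omega> * blinfun_apply (G (S \<omega>)) (W \<omega>) \<partial>P) = 0"
proof -
  define R where "R = S ` space P"
  define C where "C z = A \<inter> S -` {z} \<inter> space P" for z
  have sp: "space F = space P" using sub by (simp add: subalgebra_def)
  have R: "finite R" using S sp by (simp add: R_def simple_function_def)
  have CF: "C z \<in> sets F" for z
    using simple_functionD(2)[OF S, of "{z}"] A sp by (auto simp: C_def Int_assoc)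
  then have CP: "C z \<in> sets P" for z
    using sub by (auto simp: subalgebra_def)
  have int: "integrable P (\<lambda>\<omega>. indicator (C z) \<omega> *\<^sub>R W \<omega>)" for z
    using integrable_mult_indicator[OF CP W] .
  have zero: "(\<integral>\<omega>. indicator (C z) \<omega> *\<^sub>R W \<omega> \<partial>P) = 0" for z
    using cond[OF CF[of z]] by (simp add: set_lebesgue_integral_def)
  have eq: "indicator A \<omega> * blinfun_apply (G (S \<omega>)) (W \<omega>)
      = (\<Sum>z\<in>R. blinfun_apply (G z) (indicator (C z) \<omega> *\<^sub>R W \<omega>))"
    if "\<omega> \<in> space P" for \<omega>
  proof -
    have "(\<Sum>z\<in>R. blinfun_apply (G z) (indicator (C z) \<omega> *\<^sub>R W \<omega>))
        = (\<Sum>z\<in>R. if z = S \<omega> then indicator A \<omega> * blinfun_apply (G z) (W \<omega>) else 0)"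
      using that by (intro sum.cong) (auto simp: C_def indicator_def)
    also have "\<dots> = indicator A \<omega> * blinfun_apply (G (S \<omega>)) (W \<omega>)"
      using that R by (simp add: R_def)
    finally show ?thesis by simp
  qed
  have "integrable P (\<lambda>\<omega>. \<Sum>z\<in>R. blinfun_apply (G z) (indicator (C z) \<omega> *\<^sub>R W \<omega>))"
    using int by (intro Bochner_Integration.integrable_sum integrable_bounded_linear[OF blinfun.bounded_linear_right])
  then show "integrable P (\<lambda>\<omega>. indicator A \<omega> * blinfun_apply (G (S \<omega>)) (W \<omega>))"
    using eq by (simp cong: Bochner_Integration.integrable_cong)
  have "(\<integral>\<omega>. indicator A \<omega> * blinfun_apply (G (S \<omega>)) (W \<omega>) \<partial>P)
      = (\<integral>\<omega>. (\<Sum>z\<in>R. blinfun_apply (G z) (indicator (C z) \<omega> *\<^sub>R W \<omega>)) \<partial>P)"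
    using eq by (intro Bochner_Integration.integral_cong) auto
  also have "\<dots> = (\<Sum>z\<in>R. blinfun_apply (G z) (\<integral>\<omega>. indicator (C z) \<omega> *\<^sub>R W \<omega> \<partial>P))"
    using int
    by (subst Bochner_Integration.integral_sum)
      (auto intro!: sum.cong integral_bounded_linear[OF blinfun.bounded_linear_right]
        integrable_bounded_linear[OF blinfun.bounded_linear_right])
  also have "\<dots> = 0" using zero by simp
  finally show "(\<integral>\<omega>. indicator A \<omega> * blinfun_apply (G (S \<omega>)) (W \<omega>) \<partial>P) = 0" .
qed

text \<open>
  The bounds on \<open>A\<close> make every integral finite. The expansion point \<open>Z\<close> is replaced by \<open>F\<close>-simple
  functions \<open>S n\<close> converging to it, for which the linear term has integral zero by the previous
  lemma; the subgradients then disappear from the inequality, which passes to the limit by dominated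
  convergence.
\<close>

lemma centred_second_moment_truncated:
  fixes Z V Y :: "'w \<Rightarrow> 'v::{banach, second_countable_topology}"
  assumes fin: "finite_measure P" and sub: "subalgebra P F"
    and smooth: "strongly_smooth M (\<lambda>x :: 'v. (norm x)\<^sup>2)" and M: "0 \<le> M"
    and subgrad: "\<And>x :: 'v. subdifferential (\<lambda>x. (norm x)\<^sup>2) x \<noteq> {}"
    and Z: "Z \<in> borel_measurable F" and V: "V \<in> borel_measurable F"
    and cond: "has_cond_exp P F Y V"
    and Y2: "integrable P (\<lambda>\<omega>. (norm (Y \<omega>))\<^sup>2)"
    and A: "A \<in> sets F" and bnd: "\<And>\<omega>. \<omega> \<in> A \<Longrightarrow> norm (Z \<omega>) \<le> k" "\<And>\<omega>. \<omega> \<in> A \<Longrightarrow> norm (V \<omega>) \<le> k"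
  shows "integrable P (\<lambda>\<omega>. indicator A \<omega> * (norm (Z \<omega> + Y \<omega>))\<^sup>2)" (is "integrable P ?L")
    and "integrable P (\<lambda>\<omega>. indicator A \<omega> * (norm (Z \<omega> + V \<omega>))\<^sup>2)" (is "integrable P ?R")
    and "(\<integral>\<omega>. indicator A \<omega> * (norm (Z \<omega> + Y \<omega>))\<^sup>2 \<partial>P)
      \<le> (\<integral>\<omega>. indicator A \<omega> * (norm (Z \<omega> + V \<omega>))\<^sup>2 \<partial>P) + M / 2 * (\<integral>\<omega>. (norm (Y \<omega>))\<^sup>2 \<partial>P)"
proof -
  interpret finite_measure P by fact
  define G :: "'v \<Rightarrow> 'v \<Rightarrow>\<^sub>L real" where "G x = (SOME p. p \<in> subdifferential (\<lambda>x. (norm x)\<^sup>2) x)" for x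
  have G: "G x \<in> subdifferential (\<lambda>x. (norm x)\<^sup>2) x" for x
    using subgrad[of x] by (simp add: G_def some_in_eq)
  have Yi: "integrable P Y" and Vi: "integrable P V"
    using has_cond_expD[OF cond] by blast+
  note [measurable] = borel_measurable_integrable[OF Yi] borel_measurable_integrable[OF Vi]
    measurable_from_subalg[OF sub Z]
  have [measurable]: "A \<in> sets P" using A sub by (auto simp: subalgebra_def)
  obtain S where "(\<forall>n. simple_function F (S n)) \<and>
      (\<forall>\<omega>\<in>space F. (\<lambda>n. S n \<omega>) \<longlonglongrightarrow> Z \<omega>) \<and>
      (\<forall>n. \<forall>\<omega>\<in>space F. dist (S n \<omega>) 0 \<le> 2 * dist (Z \<omega>) 0)"
    using borel_measurable_implies_sequence_metric[OF Z, of 0] by (elim exE) (rule that)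
  then have S: "\<And>n. simple_function F (S n)"
      "\<And>\<omega>. \<omega> \<in> space F \<Longrightarrow> (\<lambda>n. S n \<omega>) \<longlonglongrightarrow> Z \<omega>"
      "\<And>n \<omega>. \<omega> \<in> space F \<Longrightarrow> norm (S n \<omega>) \<le> 2 * norm (Z \<omega>)"
    by auto
  have sp: "space F = space P" using sub by (simp add: subalgebra_def)
  have S_meas [measurable]: "S n \<in> borel_measurable P" for n
    using measurable_from_subalg[OF sub borel_measurable_simple_function[OF S(1)]] .
  have W0: "(LINT \<omega>:B|P. Y \<omega> - V \<omega>) = 0" if "B \<in> sets F" for B
  proof -
    have "B \<in> sets P" using that sub by (auto simp: subalgebra_def)
    then have "set_integrable P B Y" "set_integrable P B V"
      using Yi Vi by (auto simp: set_integrable_def intro: integrable_mult_indicator)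
    then show ?thesis
      using has_cond_expD(5)[OF cond that] by (simp add: set_integral_diff)
  qed
  \<comment> \<open>The approximations satisfy \<open>norm (S n \<omega>) \<le> 2 * norm (Z \<omega>)\<close>, whence the bound \<open>2 * k\<close>; the
    dominating function \<open>D\<close> has to serve both for \<open>Y\<close> and for \<open>V\<close>, which is at most \<open>k\<close> on \<open>A\<close>.\<close>
  have sq: "(norm (x + y))\<^sup>2 \<le> 8 * k\<^sup>2 + 2 * (norm y)\<^sup>2" if "norm x \<le> 2 * k" for x y :: 'v
  proof -
    have "(norm (x + y))\<^sup>2 \<le> (2 * k + norm y)\<^sup>2"
      using that norm_triangle_ineq[of x y] by (intro power_mono) auto
    also have "\<dots> \<le> 8 * k\<^sup>2 + 2 * (norm y)\<^sup>2"
      using sum_squares_bound[of "2 * k" "norm y"] by (simp add: power2_eq_square algebra_simps)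
    finally show ?thesis .
  qed
  define D where "D = (\<lambda>\<omega>. 10 * k\<^sup>2 + 2 * (norm (Y \<omega>))\<^sup>2)"
  have D: "integrable P D"
    using Y2 by (simp add: D_def)
  have dom: "norm (indicator A \<omega> * (norm (x + y))\<^sup>2) \<le> D \<omega>"
    if "\<omega> \<in> A \<Longrightarrow> norm x \<le> 2 * k" "\<omega> \<in> A \<Longrightarrow> norm y \<le> k \<or> y = Y \<omega>" for \<omega> and x y :: 'v
  proof (cases "\<omega> \<in> A")
    case True
    have "(norm y)\<^sup>2 \<le> k\<^sup>2 \<or> y = Y \<omega>"
      using that(2)[OF True] by (auto intro: power_mono)
    moreover have "0 \<le> k\<^sup>2" "0 \<le> (norm (Y \<omega>))\<^sup>2" by simp_all
    moreover have "(norm (x + y))\<^sup>2 \<le> 8 * k\<^sup>2 + 2 * (norm y)\<^sup>2"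
      using sq that(1) True by blast
    ultimately have "(norm (x + y))\<^sup>2 \<le> D \<omega>"
      unfolding D_def by (elim disjE) (linarith, hypsubst, linarith)
    then show ?thesis using True by simp
  next
    case False
    then show ?thesis by (simp add: D_def)
  qed
  have SA: "norm (S n \<omega>) \<le> 2 * k" "norm (Z \<omega>) \<le> 2 * k" if "\<omega> \<in> A" for n \<omega>
  proof -
    have "\<omega> \<in> space F" using that A sets.sets_into_space by blast
    then show "norm (S n \<omega>) \<le> 2 * k" using S(3)[of \<omega> n] bnd(1)[OF that] by simp
    show "norm (Z \<omega>) \<le> 2 * k" using bnd(1)[OF that] norm_ge_zero[of "Z \<omega>"] by linarith
  qed
  have lim: "AE \<omega> in P. (\<lambda>n. indicator A \<omega> * (norm (S n \<omega> + U \<omega>))\<^sup>2)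
      \<longlonglongrightarrow> indicator A \<omega> * (norm (Z \<omega> + U \<omega>))\<^sup>2" for U
    using S(2) sp by (intro AE_I2 tendsto_intros) auto
  have domY: "AE \<omega> in P. norm (indicator A \<omega> * (norm (S n \<omega> + Y \<omega>))\<^sup>2) \<le> D \<omega>" for n
    using SA by (intro AE_I2 dom) auto
  have domV: "AE \<omega> in P. norm (indicator A \<omega> * (norm (S n \<omega> + V \<omega>))\<^sup>2) \<le> D \<omega>" for n
    using SA bnd(2) by (intro AE_I2 dom) auto
  have intY: "integrable P (\<lambda>\<omega>. indicator A \<omega> * (norm (S n \<omega> + Y \<omega>))\<^sup>2)" for n
    by (rule Bochner_Integration.integrable_bound[OF D]) (use domY[of n] in \<open>auto simp: D_def\<close>)
  have intV: "integrable P (\<lambda>\<omega>. indicator A \<omega> * (norm (S n \<omega> + V \<omega>))\<^sup>2)" for n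
    by (rule Bochner_Integration.integrable_bound[OF D]) (use domV[of n] in \<open>auto simp: D_def\<close>)
  show "integrable P ?L" "integrable P ?R"
    using integrable_dominated_convergence[OF _ _ D lim domY]
      integrable_dominated_convergence[OF _ _ D lim domV] by auto
  have step: "(\<integral>\<omega>. indicator A \<omega> * (norm (S n \<omega> + Y \<omega>))\<^sup>2 \<partial>P)
      \<le> (\<integral>\<omega>. indicator A \<omega> * (norm (S n \<omega> + V \<omega>))\<^sup>2 \<partial>P) + M / 2 * (\<integral>\<omega>. (norm (Y \<omega>))\<^sup>2 \<partial>P)" for n
  proof -
    note zero = integral_blinfun_simple_cond_centred[OF sub Bochner_Integration.integrable_diff[OF Yi Vi] W0 S(1)[of n] A, of G]
    have "(\<integral>\<omega>. indicator A \<omega> * (norm (S n \<omega> + Y \<omega>))\<^sup>2 \<partial>P)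
        \<le> (\<integral>\<omega>. indicator A \<omega> * (norm (S n \<omega> + V \<omega>))\<^sup>2
            + indicator A \<omega> * blinfun_apply (G (S n \<omega>)) (Y \<omega> - V \<omega>)
            + M / 2 * (norm (Y \<omega>))\<^sup>2 \<partial>P)"
    proof (rule integral_mono)
      show "indicator A \<omega> * (norm (S n \<omega> + Y \<omega>))\<^sup>2
          \<le> indicator A \<omega> * (norm (S n \<omega> + V \<omega>))\<^sup>2
            + indicator A \<omega> * blinfun_apply (G (S n \<omega>)) (Y \<omega> - V \<omega>)
            + M / 2 * (norm (Y \<omega>))\<^sup>2" for \<omega>
        using strongly_smooth_shifted_bound[OF smooth G, of "S n \<omega>" "Y \<omega>" "V \<omega>"] M
        by (auto simp: indicator_def)
    qed (use intY intV zero(1) Y2 in auto)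
    also have "\<dots> = (\<integral>\<omega>. indicator A \<omega> * (norm (S n \<omega> + V \<omega>))\<^sup>2 \<partial>P) + M / 2 * (\<integral>\<omega>. (norm (Y \<omega>))\<^sup>2 \<partial>P)"
      using intV zero Y2 by simp
    finally show ?thesis .
  qed
  show "(\<integral>\<omega>. ?L \<omega> \<partial>P) \<le> (\<integral>\<omega>. ?R \<omega> \<partial>P) + M / 2 * (\<integral>\<omega>. (norm (Y \<omega>))\<^sup>2 \<partial>P)"
  proof (rule LIMSEQ_le)
    show "(\<lambda>n. \<integral>\<omega>. indicator A \<omega> * (norm (S n \<omega> + Y \<omega>))\<^sup>2 \<partial>P) \<longlonglongrightarrow> (\<integral>\<omega>. ?L \<omega> \<partial>P)"
      using integral_dominated_convergence[OF _ _ D lim domY] by simp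
    show "(\<lambda>n. (\<integral>\<omega>. indicator A \<omega> * (norm (S n \<omega> + V \<omega>))\<^sup>2 \<partial>P) + M / 2 * (\<integral>\<omega>. (norm (Y \<omega>))\<^sup>2 \<partial>P))
        \<longlonglongrightarrow> (\<integral>\<omega>. ?R \<omega> \<partial>P) + M / 2 * (\<integral>\<omega>. (norm (Y \<omega>))\<^sup>2 \<partial>P)"
      using integral_dominated_convergence[OF _ _ D lim domV] by (intro tendsto_intros) simp
  qed (use step in auto)
qed

text \<open>
  Truncation is by sets of \<open>F\<close>, so it does not disturb the conditional mean. The truncation levels
  exhaust the space, and monotone convergence removes them even when \<open>X\<close> or \<open>V\<close> has
  an infinite second moment.
\<close>

lemma centred_second_moment_le:
  fixes X V Y :: "'w \<Rightarrow> 'v::{banach, second_countable_topology}"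
  assumes fin: "finite_measure P"
    and smooth: "strongly_smooth M (\<lambda>x :: 'v. (norm x)\<^sup>2)" and M: "0 < M"
    and subgrad: "\<And>x :: 'v. subdifferential (\<lambda>x. (norm x)\<^sup>2) x \<noteq> {}"
    and X: "X' \<in> borel_measurable F" "AE \<omega> in P. X \<omega> = X' \<omega>"
    and cond: "has_cond_exp P F Y V"
  shows "(\<integral>\<^sup>+\<omega>. ennreal ((norm (X \<omega> + Y \<omega> - V \<omega>))\<^sup>2) \<partial>P)
    \<le> (\<integral>\<^sup>+\<omega>. ennreal ((norm (X \<omega>))\<^sup>2) \<partial>P) + ennreal (M / 2) * (\<integral>\<^sup>+\<omega>. ennreal ((norm (Y \<omega>))\<^sup>2) \<partial>P)"
    (is "?lhs \<le> ?rhs")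
proof (cases "(\<integral>\<^sup>+\<omega>. ennreal ((norm (Y \<omega>))\<^sup>2) \<partial>P) = \<infinity>")
  case True
  then show ?thesis using M by (simp add: ennreal_mult_top)
next
  case False
  have sub: "subalgebra P F" and Yi: "integrable P Y"
    using has_cond_expD[OF cond] by blast+
  obtain V' where V': "V' \<in> borel_measurable F" "AE \<omega> in P. V \<omega> = V' \<omega>"
    using has_cond_expD(4)[OF cond] by blast
  note [measurable] = borel_measurable_integrable[OF Yi] X(1) V'(1)
    measurable_from_subalg[OF sub X(1)] measurable_from_subalg[OF sub V'(1)]
  have Y2: "integrable P (\<lambda>\<omega>. (norm (Y \<omega>))\<^sup>2)"
    using False by (intro integrableI_nonneg) (auto simp: less_top)
  have cond': "has_cond_exp P F Y V'"
  proof -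
    have [measurable]: "V \<in> borel_measurable P"
      using has_cond_expD(3)[OF cond] by (rule borel_measurable_integrable)
    have "integrable P V'"
      using has_cond_expD(3)[OF cond] V'(2) by (subst (asm) integrable_cong_AE[of _ _ V']) auto
    moreover have "(LINT \<omega>:A|P. V \<omega>) = (LINT \<omega>:A|P. V' \<omega>)" if "A \<in> sets F" for A
    proof -
      have [measurable]: "A \<in> sets P" using that sub by (auto simp: subalgebra_def)
      show ?thesis unfolding set_lebesgue_integral_def
        using V'(2) by (intro integral_cong_AE) auto
    qed
    ultimately show ?thesis
      unfolding has_cond_exp_def using has_cond_expD(5)[OF cond] V'(1) sub Yi
      by (intro conjI ballI bexI[of _ V'] AE_I2) auto
  qed
  define Z where "Z = (\<lambda>\<omega>. X' \<omega> - V' \<omega>)"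
  have Z [measurable]: "Z \<in> borel_measurable F" "Z \<in> borel_measurable P"
    by (auto simp: Z_def)
  define A where "A n = {\<omega> \<in> space F. norm (Z \<omega>) \<le> real n \<and> norm (V' \<omega>) \<le> real n}" for n
  have AF: "A n \<in> sets F" for n unfolding A_def by measurable
  then have AP [measurable]: "A n \<in> sets P" for n using sub by (auto simp: subalgebra_def)
  have trunc: "(\<integral>\<^sup>+\<omega>. ennreal (indicator (A n) \<omega> * (norm (Z \<omega> + Y \<omega>))\<^sup>2) \<partial>P) \<le> ?rhs" for n
  proof -
    note tr = centred_second_moment_truncated[OF fin sub smooth less_imp_le[OF M] subgrad
        Z(1) V'(1) cond' Y2 AF, of n "real n"]
    have b: "norm (Z \<omega>) \<le> real n" "norm (V' \<omega>) \<le> real n" if "\<omega> \<in> A n" for \<omega>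
      using that by (auto simp: A_def)
    have "(\<integral>\<^sup>+\<omega>. ennreal (indicator (A n) \<omega> * (norm (Z \<omega> + Y \<omega>))\<^sup>2) \<partial>P)
        = ennreal (\<integral>\<omega>. indicator (A n) \<omega> * (norm (Z \<omega> + Y \<omega>))\<^sup>2 \<partial>P)"
      using tr(1)[OF b] by (intro nn_integral_eq_integral) auto
    also have "\<dots> \<le> ennreal ((\<integral>\<omega>. indicator (A n) \<omega> * (norm (Z \<omega> + V' \<omega>))\<^sup>2 \<partial>P) + M / 2 * (\<integral>\<omega>. (norm (Y \<omega>))\<^sup>2 \<partial>P))"
      using tr(3)[OF b] by (intro ennreal_leI)
    also have "\<dots> = ennreal (\<integral>\<omega>. indicator (A n) \<omega> * (norm (Z \<omega> + V' \<omega>))\<^sup>2 \<partial>P)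
        + ennreal (M / 2) * ennreal (\<integral>\<omega>. (norm (Y \<omega>))\<^sup>2 \<partial>P)"
      using M by (subst ennreal_plus) (auto simp del: times_divide_eq_left simp: ennreal_mult)
    also have "\<dots> = (\<integral>\<^sup>+\<omega>. ennreal (indicator (A n) \<omega> * (norm (Z \<omega> + V' \<omega>))\<^sup>2) \<partial>P)
        + ennreal (M / 2) * (\<integral>\<^sup>+\<omega>. ennreal ((norm (Y \<omega>))\<^sup>2) \<partial>P)"
      using tr(2)[OF b] Y2 by (simp add: nn_integral_eq_integral)
    also have "(\<integral>\<^sup>+\<omega>. ennreal (indicator (A n) \<omega> * (norm (Z \<omega> + V' \<omega>))\<^sup>2) \<partial>P)
        \<le> (\<integral>\<^sup>+\<omega>. ennreal ((norm (X \<omega>))\<^sup>2) \<partial>P)"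
      using X(2) by (intro nn_integral_mono_AE) (auto simp: Z_def indicator_def elim!: AE_mp)
    finally show ?thesis by (simp add: add_mono)
  qed
  have sup: "(SUP n. ennreal (indicator (A n) \<omega> * (norm (Z \<omega> + Y \<omega>))\<^sup>2)) = ennreal ((norm (Z \<omega> + Y \<omega>))\<^sup>2)"
    if "\<omega> \<in> space P" for \<omega>
  proof (rule antisym)
    obtain n where "max (norm (Z \<omega>)) (norm (V' \<omega>)) \<le> real n" using real_arch_simple by blast
    then have "\<omega> \<in> A n" using that sub by (auto simp: A_def subalgebra_def)
    then show "ennreal ((norm (Z \<omega> + Y \<omega>))\<^sup>2) \<le> (SUP n. ennreal (indicator (A n) \<omega> * (norm (Z \<omega> + Y \<omega>))\<^sup>2))"
      by (intro SUP_upper2[of n]) auto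
  qed (auto intro!: SUP_least ennreal_leI simp: indicator_def)
  have "?lhs = (\<integral>\<^sup>+\<omega>. ennreal ((norm (Z \<omega> + Y \<omega>))\<^sup>2) \<partial>P)"
    using X(2) V'(2) by (intro nn_integral_cong_AE) (auto simp: Z_def algebra_simps)
  also have "\<dots> = (\<integral>\<^sup>+\<omega>. (SUP n. ennreal (indicator (A n) \<omega> * (norm (Z \<omega> + Y \<omega>))\<^sup>2)) \<partial>P)"
    using sup by (intro nn_integral_cong) simp
  also have "\<dots> = (SUP n. \<integral>\<^sup>+\<omega>. ennreal (indicator (A n) \<omega> * (norm (Z \<omega> + Y \<omega>))\<^sup>2) \<partial>P)"
  proof (rule nn_integral_monotone_convergence_SUP)
    show "incseq (\<lambda>n \<omega>. ennreal (indicator (A n) \<omega> * (norm (Z \<omega> + Y \<omega>))\<^sup>2))"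
      by (auto simp: incseq_def le_fun_def A_def indicator_def intro!: ennreal_leI)
  qed measurable
  also have "\<dots> \<le> ?rhs"
    using trunc by (rule SUP_least)
  finally show ?thesis .
qed

section \<open>One step of the momentum recursion\<close>

lemma norm_linear_combination_squared_le:
  fixes x y :: "'v::real_normed_vector"
  shows "(norm (a *\<^sub>R x + b *\<^sub>R y))\<^sup>2 \<le> 2 * a\<^sup>2 * (norm x)\<^sup>2 + 2 * b\<^sup>2 * (norm y)\<^sup>2"
proof -
  have "(norm (a *\<^sub>R x + b *\<^sub>R y))\<^sup>2 \<le> (\<bar>a\<bar> * norm x + \<bar>b\<bar> * norm y)\<^sup>2"
    using norm_triangle_ineq[of "a *\<^sub>R x" "b *\<^sub>R y"] by (intro power_mono) auto
  also have "\<dots> \<le> 2 * (\<bar>a\<bar> * norm x)\<^sup>2 + 2 * (\<bar>b\<bar> * norm y)\<^sup>2"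
    using sum_squares_bound[of "\<bar>a\<bar> * norm x" "\<bar>b\<bar> * norm y"] by (simp add: power2_sum)
  finally show ?thesis by (simp add: power_mult_distrib mult.assoc)
qed

lemma has_cond_exp_momentum_increment:
  fixes g m \<mu> \<mu>' :: "'w \<Rightarrow> 'v::{banach, second_countable_topology}"
  assumes g: "has_cond_exp P F g \<mu>" and m: "has_cond_exp P F m \<mu>'"
  shows "has_cond_exp P F (\<lambda>\<omega>. c *\<^sub>R (g \<omega> - \<mu> \<omega>) + (1 - c) *\<^sub>R (g \<omega> - m \<omega>))
    (\<lambda>\<omega>. (1 - c) *\<^sub>R (\<mu> \<omega> - \<mu>' \<omega>))" (is "has_cond_exp P F ?Y ?V")
  unfolding has_cond_exp_def
proof (intro conjI ballI)
  note gD = has_cond_expD[OF g] and mD = has_cond_expD[OF m]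
  show "subalgebra P F" by (rule gD)
  show "integrable P ?Y" "integrable P ?V" using gD(2,3) mD(2,3) by simp_all
  obtain U U' where "U \<in> borel_measurable F" "AE \<omega> in P. \<mu> \<omega> = U \<omega>"
      "U' \<in> borel_measurable F" "AE \<omega> in P. \<mu>' \<omega> = U' \<omega>"
    using gD(4) mD(4) by blast
  then show "\<exists>Z\<in>borel_measurable F. AE \<omega> in P. ?V \<omega> = Z \<omega>"
    by (intro bexI[of _ "\<lambda>\<omega>. (1 - c) *\<^sub>R (U \<omega> - U' \<omega>)"]) auto
  fix A assume A: "A \<in> sets F"
  then have AP: "A \<in> sets P" using gD(1) by (auto simp: subalgebra_def)
  define J where "J f = (\<integral>\<omega>. indicator A \<omega> *\<^sub>R f \<omega> \<partial>P)" for f :: "'w \<Rightarrow> 'v"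
  have int: "integrable P (\<lambda>\<omega>. indicator A \<omega> *\<^sub>R f \<omega>)" if "integrable P f" for f :: "'w \<Rightarrow> 'v"
    using integrable_mult_indicator[OF AP that] .
  have "J ?Y = (\<integral>\<omega>. indicator A \<omega> *\<^sub>R g \<omega> - c *\<^sub>R (indicator A \<omega> *\<^sub>R \<mu> \<omega>)
      - (1 - c) *\<^sub>R (indicator A \<omega> *\<^sub>R m \<omega>) \<partial>P)"
    unfolding J_def by (intro Bochner_Integration.integral_cong) (auto simp: algebra_simps)
  also have "\<dots> = J g - c *\<^sub>R J \<mu> - (1 - c) *\<^sub>R J m"
    using int gD(2,3) mD(2) by (simp add: J_def del: scaleR_scaleR)
  also have "\<dots> = (1 - c) *\<^sub>R (J \<mu> - J \<mu>')"
    using gD(5)[OF A] mD(5)[OF A] by (simp add: J_def set_lebesgue_integral_def algebra_simps)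
  also have "\<dots> = (\<integral>\<omega>. (1 - c) *\<^sub>R (indicator A \<omega> *\<^sub>R \<mu> \<omega> - indicator A \<omega> *\<^sub>R \<mu>' \<omega>) \<partial>P)"
    using int gD(3) mD(3) by (simp add: J_def del: scaleR_scaleR)
  also have "\<dots> = J ?V"
    unfolding J_def by (intro Bochner_Integration.integral_cong) (auto simp: algebra_simps)
  finally show "(LINT \<omega>:A|P. ?Y \<omega>) = (LINT \<omega>:A|P. ?V \<omega>)"
    unfolding J_def set_lebesgue_integral_def .
qed

text \<open>
  The error is \<open>X + Y - V\<close> with \<open>X = (1 - c) (d - \<mu>')\<close> and \<open>V = E[Y | F]\<close>. Writing the noise as
  \<open>c (g - \<mu>) + (1 - c) (g - m)\<close> minus its conditional mean keeps the two second moments that occur in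
  the bound, without \<open>\<mu> - \<mu>'\<close>.
\<close>

lemma momentum_error_step:
  fixes d g m \<mu> \<mu>' :: "'w \<Rightarrow> 'v::{banach, second_countable_topology}"
  assumes fin: "finite_measure P"
    and smooth: "strongly_smooth M (\<lambda>x :: 'v. (norm x)\<^sup>2)" and M: "0 < M"
    and subgrad: "\<And>x :: 'v. subdifferential (\<lambda>x. (norm x)\<^sup>2) x \<noteq> {}"
    and d: "d \<in> borel_measurable F"
    and g: "has_cond_exp P F g \<mu>" and m: "has_cond_exp P F m \<mu>'"
  shows "(\<integral>\<^sup>+\<omega>. ennreal ((norm (g \<omega> + (1 - c) *\<^sub>R (d \<omega> - m \<omega>) - \<mu> \<omega>))\<^sup>2) \<partial>P)
    \<le> ennreal ((1 - c)\<^sup>2) * (\<integral>\<^sup>+\<omega>. ennreal ((norm (d \<omega> - \<mu>' \<omega>))\<^sup>2) \<partial>P)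
      + (ennreal (M * c\<^sup>2) * (\<integral>\<^sup>+\<omega>. ennreal ((norm (g \<omega> - \<mu> \<omega>))\<^sup>2) \<partial>P)
        + ennreal (M * (1 - c)\<^sup>2) * (\<integral>\<^sup>+\<omega>. ennreal ((norm (g \<omega> - m \<omega>))\<^sup>2) \<partial>P))"
proof -
  define X Y V where "X = (\<lambda>\<omega>. (1 - c) *\<^sub>R (d \<omega> - \<mu>' \<omega>))"
    and "Y = (\<lambda>\<omega>. c *\<^sub>R (g \<omega> - \<mu> \<omega>) + (1 - c) *\<^sub>R (g \<omega> - m \<omega>))"
    and "V = (\<lambda>\<omega>. (1 - c) *\<^sub>R (\<mu> \<omega> - \<mu>' \<omega>))"
  note gD = has_cond_expD[OF g] and mD = has_cond_expD[OF m]
  note [measurable] = borel_measurable_integrable[OF gD(2)] borel_measurable_integrable[OF gD(3)]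
    borel_measurable_integrable[OF mD(2)] borel_measurable_integrable[OF mD(3)]
    measurable_from_subalg[OF gD(1) d]
  have cond: "has_cond_exp P F Y V"
    unfolding Y_def V_def by (rule has_cond_exp_momentum_increment[OF g m])
  obtain U where U: "U \<in> borel_measurable F" "AE \<omega> in P. \<mu>' \<omega> = U \<omega>"
    using mD(4) by blast
  have X': "(\<lambda>\<omega>. (1 - c) *\<^sub>R (d \<omega> - U \<omega>)) \<in> borel_measurable F"
    "AE \<omega> in P. X \<omega> = (1 - c) *\<^sub>R (d \<omega> - U \<omega>)"
    using d U by (auto simp: X_def)
  have "g \<omega> + (1 - c) *\<^sub>R (d \<omega> - m \<omega>) - \<mu> \<omega> = X \<omega> + Y \<omega> - V \<omega>" for \<omega>
    by (simp add: X_def Y_def V_def algebra_simps)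
  then have "(\<integral>\<^sup>+\<omega>. ennreal ((norm (g \<omega> + (1 - c) *\<^sub>R (d \<omega> - m \<omega>) - \<mu> \<omega>))\<^sup>2) \<partial>P)
      = (\<integral>\<^sup>+\<omega>. ennreal ((norm (X \<omega> + Y \<omega> - V \<omega>))\<^sup>2) \<partial>P)"
    by simp
  also have "\<dots> \<le> (\<integral>\<^sup>+\<omega>. ennreal ((norm (X \<omega>))\<^sup>2) \<partial>P)
      + ennreal (M / 2) * (\<integral>\<^sup>+\<omega>. ennreal ((norm (Y \<omega>))\<^sup>2) \<partial>P)"
    by (rule centred_second_moment_le[OF fin smooth M subgrad X' cond])
  also have "(\<integral>\<^sup>+\<omega>. ennreal ((norm (X \<omega>))\<^sup>2) \<partial>P)
      = ennreal ((1 - c)\<^sup>2) * (\<integral>\<^sup>+\<omega>. ennreal ((norm (d \<omega> - \<mu>' \<omega>))\<^sup>2) \<partial>P)"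
    by (simp add: X_def power_mult_distrib ennreal_mult nn_integral_cmult)
  also have "ennreal (M / 2) * (\<integral>\<^sup>+\<omega>. ennreal ((norm (Y \<omega>))\<^sup>2) \<partial>P)
      \<le> (\<integral>\<^sup>+\<omega>. ennreal (M * c\<^sup>2) * ennreal ((norm (g \<omega> - \<mu> \<omega>))\<^sup>2)
          + ennreal (M * (1 - c)\<^sup>2) * ennreal ((norm (g \<omega> - m \<omega>))\<^sup>2) \<partial>P)"
  proof -
    have "ennreal (M / 2) * ennreal ((norm (Y \<omega>))\<^sup>2)
        \<le> ennreal (M * c\<^sup>2) * ennreal ((norm (g \<omega> - \<mu> \<omega>))\<^sup>2)
          + ennreal (M * (1 - c)\<^sup>2) * ennreal ((norm (g \<omega> - m \<omega>))\<^sup>2)" for \<omega>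
    proof -
      have "M / 2 * (norm (Y \<omega>))\<^sup>2 \<le> M / 2 * (2 * c\<^sup>2 * (norm (g \<omega> - \<mu> \<omega>))\<^sup>2
          + 2 * (1 - c)\<^sup>2 * (norm (g \<omega> - m \<omega>))\<^sup>2)"
        unfolding Y_def using M norm_linear_combination_squared_le by (intro mult_left_mono) auto
      also have "\<dots> = M * c\<^sup>2 * (norm (g \<omega> - \<mu> \<omega>))\<^sup>2 + M * (1 - c)\<^sup>2 * (norm (g \<omega> - m \<omega>))\<^sup>2"
        by (simp add: algebra_simps)
      finally have "ennreal (M / 2 * (norm (Y \<omega>))\<^sup>2)
          \<le> ennreal (M * c\<^sup>2 * (norm (g \<omega> - \<mu> \<omega>))\<^sup>2 + M * (1 - c)\<^sup>2 * (norm (g \<omega> - m \<omega>))\<^sup>2)"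
        by (rule ennreal_leI)
      moreover have "ennreal (M / 2 * (norm (Y \<omega>))\<^sup>2) = ennreal (M / 2) * ennreal ((norm (Y \<omega>))\<^sup>2)"
        "ennreal (M * c\<^sup>2 * (norm (g \<omega> - \<mu> \<omega>))\<^sup>2 + M * (1 - c)\<^sup>2 * (norm (g \<omega> - m \<omega>))\<^sup>2)
          = ennreal (M * c\<^sup>2) * ennreal ((norm (g \<omega> - \<mu> \<omega>))\<^sup>2)
          + ennreal (M * (1 - c)\<^sup>2) * ennreal ((norm (g \<omega> - m \<omega>))\<^sup>2)"
        using M by (subst ennreal_mult, simp_all) (simp add: ennreal_mult)
      ultimately show ?thesis by simp
    qed
    moreover have [measurable]: "Y \<in> borel_measurable P"
      unfolding Y_def by measurable
    ultimately show ?thesis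
      using nn_integral_cmult[of "\<lambda>\<omega>. ennreal ((norm (Y \<omega>))\<^sup>2)" P "ennreal (M / 2)"]
        nn_integral_mono[of P "\<lambda>\<omega>. ennreal (M / 2) * ennreal ((norm (Y \<omega>))\<^sup>2)"]
      by simp
  qed
  also have "\<dots> = ennreal (M * c\<^sup>2) * (\<integral>\<^sup>+\<omega>. ennreal ((norm (g \<omega> - \<mu> \<omega>))\<^sup>2) \<partial>P)
      + ennreal (M * (1 - c)\<^sup>2) * (\<integral>\<^sup>+\<omega>. ennreal ((norm (g \<omega> - m \<omega>))\<^sup>2) \<partial>P)"
    by (simp add: nn_integral_add nn_integral_cmult)
  finally show ?thesis by (simp add: add_left_mono)
qed

section \<open>Summing the recursion\<close>

text \<open>
  Multiplying the recursion at \<open>t\<close> by \<open>w t\<close> telescopes. Subtraction being unavailable in the extended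
  nonnegative reals, the induction carries the term \<open>w (Suc n) * q (Suc n) * e n\<close> that the next step
  consumes on the left-hand side.
\<close>

lemma weighted_recursion_sum_le:
  fixes e r :: "nat \<Rightarrow> ennreal" and q w :: "nat \<Rightarrow> real"
  assumes e0: "e 0 = 0"
    and step: "\<And>t. t \<in> {1..T} \<Longrightarrow> e t \<le> ennreal (q t) * e (t - 1) + r t"
    and q: "\<And>t. 0 \<le> q t" and w: "\<And>t. 0 \<le> w t"
    and weights: "\<And>t. 1 + w (Suc t) * q (Suc t) \<le> w t"
  shows "(\<Sum>t = 1..T. e t) \<le> (\<Sum>t = 1..T. ennreal (w t) * r t)"
proof -
  have "(\<Sum>t = 1..n. e t) + ennreal (w (Suc n) * q (Suc n)) * e n \<le> (\<Sum>t = 1..n. ennreal (w t) * r t)"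
    if "n \<le> T" for n
    using that
  proof (induction n)
    case 0
    then show ?case by (simp add: e0)
  next
    case (Suc n)
    have "e (Suc n) + ennreal (w (Suc (Suc n)) * q (Suc (Suc n))) * e (Suc n)
        = ennreal (1 + w (Suc (Suc n)) * q (Suc (Suc n))) * e (Suc n)"
      using q w by (simp add: distrib_right)
    also have "\<dots> \<le> ennreal (w (Suc n)) * e (Suc n)"
      using weights by (intro mult_right_mono ennreal_leI) auto
    also have "\<dots> \<le> ennreal (w (Suc n)) * (ennreal (q (Suc n)) * e n + r (Suc n))"
      using step[of "Suc n"] Suc.prems by (intro mult_left_mono) auto
    also have "\<dots> = ennreal (w (Suc n) * q (Suc n)) * e n + ennreal (w (Suc n)) * r (Suc n)"
      using q w by (simp add: distrib_left ennreal_mult mult.assoc)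
    finally have "(\<Sum>t = 1..n. e t) + (e (Suc n) + ennreal (w (Suc (Suc n)) * q (Suc (Suc n))) * e (Suc n))
        \<le> (\<Sum>t = 1..n. e t) + (ennreal (w (Suc n) * q (Suc n)) * e n + ennreal (w (Suc n)) * r (Suc n))"
      by (rule add_left_mono)
    also have "\<dots> \<le> (\<Sum>t = 1..n. ennreal (w t) * r t) + ennreal (w (Suc n)) * r (Suc n)"
      using Suc.IH Suc.prems by (simp add: add.assoc[symmetric] add_right_mono)
    finally show ?case by (simp add: add.assoc)
  qed
  from this[of T] have "(\<Sum>t = 1..T. e t) + ennreal (w (Suc T) * q (Suc T)) * e T
      \<le> (\<Sum>t = 1..T. ennreal (w t) * r t)" by simp
  then show ?thesis
    by (rule order_trans[rotated]) (simp add: add_increasing2)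
qed

text \<open>
  The tangent bound for the concave \<open>u powr (2 / 3)\<close>, whose slope is at most \<open>2 / 3\<close> on \<open>u \<ge> 1\<close>. It is
  obtained by cubing: with \<open>a\<^sup>3 = u\<^sup>2\<close> and \<open>a \<ge> 1\<close>, the expansion of \<open>(a + 2/3 h)\<^sup>3\<close> dominates that of
  \<open>(u + h)\<^sup>2\<close> term by term.
\<close>

lemma powr_two_thirds_increment_le:
  fixes u h :: real
  assumes "1 \<le> u" "0 \<le> h"
  shows "(u + h) powr (2 / 3) \<le> u powr (2 / 3) + 2 / 3 * h"
proof -
  have cube: "(x powr (2 / 3)) ^ 3 = x\<^sup>2" if "0 < x" for x :: real
  proof -
    have "(x powr (2 / 3)) ^ 3 = (x powr (2 / 3)) powr 3"
      by (rule powr_numeral[symmetric]) simp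
    also have "\<dots> = x powr 2" by (simp add: powr_powr)
    also have "\<dots> = x\<^sup>2" using that by (intro powr_numeral) simp
    finally show ?thesis .
  qed
  define a where "a = u powr (2 / 3)"
  have a: "1 \<le> a" using assms by (simp add: a_def ge_one_powr_ge_zero)
  have a3: "a ^ 3 = u\<^sup>2" using cube[of u] assms by (simp add: a_def)
  have "u\<^sup>2 \<le> (a\<^sup>2)\<^sup>2"
    using power_increasing[of 3 4 a] a a3 by (simp add: power_mult[symmetric])
  then have "u \<le> a\<^sup>2" by (rule power2_le_imp_le) simp
  then have "u * h \<le> a\<^sup>2 * h" using assms by (intro mult_right_mono)
  moreover have "1 * h\<^sup>2 \<le> a * h\<^sup>2" using a by (intro mult_right_mono) auto
  moreover have "0 \<le> h ^ 3" using assms by simp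
  moreover have "(a + 2 / 3 * h) ^ 3 = a ^ 3 + 2 * (a\<^sup>2 * h) + 4 / 3 * (a * h\<^sup>2) + 8 / 27 * h ^ 3"
    by (simp add: power3_eq_cube power2_eq_square field_simps)
  moreover have "(u + h)\<^sup>2 = u\<^sup>2 + 2 * (u * h) + h\<^sup>2"
    by (simp add: power2_sum)
  ultimately have "(u + h)\<^sup>2 \<le> (a + 2 / 3 * h) ^ 3"
    using a3 zero_le_power2[of h] by linarith
  then have "((u + h) powr (2 / 3)) ^ 3 \<le> (a + 2 / 3 * h) ^ 3"
    using cube[of "u + h"] assms by simp
  then show ?thesis
    unfolding a_def[symmetric] using a assms by (subst (asm) power_mono_iff) auto
qed

text \<open>
  The two sides are \<open>1 + 3/10 (y - 2 + 1/y)\<close> and \<open>3/10 (x + 2 + 1/x)\<close>. As \<open>1/y \<le> 1/x\<close>, it suffices that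
  \<open>3/10 (4 - (y - x)) \<ge> 1\<close>, that is, \<open>y - x \<le> 2/3\<close>.
\<close>

lemma step_size_weight_recursion:
  fixes x y :: real
  assumes "1 \<le> x" "x \<le> y" "y \<le> x + 2 / 3"
  shows "1 + 3 * (1 + y)\<^sup>2 / (10 * y) * (1 - 2 / (1 + y))\<^sup>2 \<le> 3 * (1 + x)\<^sup>2 / (10 * x)"
proof -
  have "1 / y \<le> 1 / x" using assms by (simp add: frac_le)
  moreover have "3 * (1 + y)\<^sup>2 / (10 * y) * (1 - 2 / (1 + y))\<^sup>2 = 3 / 10 * (y - 2 + 1 / y)"
  proof -
    have "1 - 2 / (1 + y) = (y - 1) / (1 + y)" using assms by (simp add: field_simps)
    then have "3 * (1 + y)\<^sup>2 / (10 * y) * (1 - 2 / (1 + y))\<^sup>2 = 3 / 10 * ((y - 1)\<^sup>2 / y)"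
      using assms by (simp add: power_divide)
    also have "(y - 1)\<^sup>2 / y = y - 2 + 1 / y"
      using assms by (simp add: power2_eq_square field_simps)
    finally show ?thesis .
  qed
  moreover have "3 * (1 + x)\<^sup>2 / (10 * x) = 3 / 10 * (x + 2 + 1 / x)"
    using assms by (simp add: power2_eq_square field_simps)
  ultimately show ?thesis using assms by simp
qed

theorem lemma4p1:
  fixes P :: "'w measure"
    and g m d \<mu> \<epsilon> :: "nat \<Rightarrow> 'w \<Rightarrow> ('a::finite_dim_normed_vector \<Rightarrow>\<^sub>L real)"
    and M \<gamma> :: real
    and \<tau> \<gamma>s :: "nat \<Rightarrow> real"
    and T :: nat
  assumes "prob_space P"
    and "T \<ge> 1"
    and "d 0 \<in> borel_measurable P"
    and "\<And>t. t \<in> {1..T} \<Longrightarrow> g t \<in> borel_measurable P"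
    and "\<And>t. t \<in> {1..T} \<Longrightarrow> m t \<in> borel_measurable P"
    and "\<And>t \<omega>. t \<in> {1..T} \<Longrightarrow> \<omega> \<in> space P \<Longrightarrow>
           d t \<omega> = g t \<omega> + (1 - \<gamma>s t) *\<^sub>R (d (t - 1) \<omega> - m t \<omega>)"
    and "strongly_smooth M (\<lambda>x :: 'a \<Rightarrow>\<^sub>L real. (norm x)\<^sup>2)"
    and "\<And>t. t \<in> {1..T} \<Longrightarrow> has_cond_exp P (sigma_of P (d (t - 1))) (g t) (\<mu> t)"
    and "\<And>t. t \<in> {1..T} \<Longrightarrow> has_cond_exp P (sigma_of P (d (t - 1))) (m t) (\<mu> (t - 1))"
    and "\<And>t \<omega>. \<epsilon> t \<omega> = d t \<omega> - \<mu> t \<omega>"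
    and "AE \<omega> in P. \<epsilon> 0 \<omega> = 0"
    and "\<And>t. \<gamma>s t = 2 / (1 + \<tau> t)"
    and "\<And>t. \<tau> t = (1 + real t * \<gamma>) powr (2 / 3)"
    and "0 < \<gamma>" "\<gamma> \<le> 1"
  shows "(\<integral>\<^sup>+ \<omega>. (\<Sum>t = 1..T. ennreal ((norm (\<epsilon> t \<omega>))\<^sup>2)) \<partial>P)
    \<le> (\<Sum>t = 1..T. ennreal (6 * M / (5 * \<tau> t)) *
          (\<integral>\<^sup>+ \<omega>. ennreal ((norm (g t \<omega> - \<mu> t \<omega>))\<^sup>2) \<partial>P))
      + (\<Sum>t = 1..T. ennreal (3 * M * (\<tau> t - 1)\<^sup>2 / (5 * \<tau> t)) *
          (\<integral>\<^sup>+ \<omega>. ennreal ((norm (g t \<omega> - m t \<omega>))\<^sup>2) \<partial>P))"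
proof (cases "\<exists>x :: 'a \<Rightarrow>\<^sub>L real. x \<noteq> 0")
  case False
  \<comment> \<open>In the trivial space \<open>M\<close> can be negative, but all errors vanish.\<close>
  then have "\<epsilon> t \<omega> = 0" for t \<omega> by blast
  then show ?thesis by simp
next
  case True
  interpret prob_space P by fact
  note d0 = assms(3) and rec = assms(6) and smooth = assms(7) and g = assms(8) and m = assms(9)
    and \<epsilon> = assms(10) and \<epsilon>0 = assms(11) and \<gamma>s = assms(12) and \<tau> = assms(13) and \<gamma> = assms(14,15)
  note [measurable] = d0 assms(4,5)
  have M: "0 < M"
    using True strongly_smooth_norm_squared_modulus[OF smooth] by force
  define w where "w t = 3 * (1 + \<tau> t)\<^sup>2 / (10 * \<tau> t)" for t
  define a b e where "a t = (\<integral>\<^sup>+\<omega>. ennreal ((norm (g t \<omega> - \<mu> t \<omega>))\<^sup>2) \<partial>P)"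
    and "b t = (\<integral>\<^sup>+\<omega>. ennreal ((norm (g t \<omega> - m t \<omega>))\<^sup>2) \<partial>P)"
    and "e t = (\<integral>\<^sup>+\<omega>. ennreal ((norm (\<epsilon> t \<omega>))\<^sup>2) \<partial>P)" for t
  have \<tau>1: "1 \<le> \<tau> t" for t
    using \<gamma> by (simp add: \<tau> ge_one_powr_ge_zero)
  have \<tau>_mono: "\<tau> t \<le> \<tau> (Suc t)" for t
    unfolding \<tau> using \<gamma> by (intro powr_mono2) (auto intro!: add_nonneg_nonneg mult_right_mono)
  have \<tau>_incr: "\<tau> (Suc t) \<le> \<tau> t + 2 / 3" for t
    using powr_two_thirds_increment_le[of "1 + real t * \<gamma>" \<gamma>] \<gamma>
    by (simp add: \<tau> algebra_simps)
  have w: "1 + w (Suc t) * (1 - \<gamma>s (Suc t))\<^sup>2 \<le> w t" for t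
    unfolding w_def \<gamma>s by (rule step_size_weight_recursion[OF \<tau>1 \<tau>_mono \<tau>_incr])
  have w0: "0 \<le> w t" for t
    using \<tau>1[of t] by (simp add: w_def)
  have \<mu>_meas: "\<mu> t \<in> borel_measurable P" if "t \<in> {1..T}" for t
    using has_cond_expD(3)[OF g[OF that]] by (rule borel_measurable_integrable)
  have "t \<le> T \<Longrightarrow> d t \<in> borel_measurable P" for t
  proof (induction t)
    case (Suc t)
    have [measurable]: "d t \<in> borel_measurable P" using Suc by simp
    have "(\<lambda>\<omega>. g (Suc t) \<omega> + (1 - \<gamma>s (Suc t)) *\<^sub>R (d t \<omega> - m (Suc t) \<omega>)) \<in> borel_measurable P"
      using assms(4,5)[of "Suc t"] Suc.prems by auto
    then show ?case
      using rec[of "Suc t"] Suc.prems by (subst measurable_cong) auto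
  qed (rule d0)
  then have \<epsilon>_meas: "\<epsilon> t \<in> borel_measurable P" if "t \<in> {1..T}" for t
    using that \<mu>_meas[OF that] unfolding \<epsilon>[abs_def] by auto
  have e0: "e 0 = 0"
  proof -
    have "e 0 = (\<integral>\<^sup>+\<omega>. 0 \<partial>P)"
      unfolding e_def using \<epsilon>0 by (intro nn_integral_cong_AE) auto
    then show ?thesis by simp
  qed
  have step: "e t \<le> ennreal ((1 - \<gamma>s t)\<^sup>2) * e (t - 1)
      + (ennreal (M * (\<gamma>s t)\<^sup>2) * a t + ennreal (M * (1 - \<gamma>s t)\<^sup>2) * b t)" if t: "t \<in> {1..T}" for t
  proof -
    have dF: "d (t - 1) \<in> borel_measurable (sigma_of P (d (t - 1)))"
      unfolding sigma_of_def by (rule measurable_vimage_algebra1) simp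
    have "e t = (\<integral>\<^sup>+\<omega>. ennreal ((norm (g t \<omega> + (1 - \<gamma>s t) *\<^sub>R (d (t - 1) \<omega> - m t \<omega>) - \<mu> t \<omega>))\<^sup>2) \<partial>P)"
      unfolding e_def \<epsilon> using rec[OF t] by (intro nn_integral_cong) simp
    also have "\<dots> \<le> ennreal ((1 - \<gamma>s t)\<^sup>2) * e (t - 1)
      + (ennreal (M * (\<gamma>s t)\<^sup>2) * a t + ennreal (M * (1 - \<gamma>s t)\<^sup>2) * b t)"
      unfolding e_def a_def b_def \<epsilon>
      by (rule momentum_error_step[OF finite_measure_axioms smooth M
            subdifferential_dual_norm_squared_nonempty dF g[OF t] m[OF t]])
    finally show ?thesis .
  qed
  have coeffs: "ennreal (w t) * (ennreal (M * (\<gamma>s t)\<^sup>2) * a t + ennreal (M * (1 - \<gamma>s t)\<^sup>2) * b t)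
      \<le> ennreal (6 * M / (5 * \<tau> t)) * a t + ennreal (3 * M * (\<tau> t - 1)\<^sup>2 / (5 * \<tau> t)) * b t" for t
  proof -
    have pos: "0 < \<tau> t" "0 < 1 + \<tau> t" using \<tau>1[of t] by simp_all
    have "w t * (M * (\<gamma>s t)\<^sup>2) = 6 * M / (5 * \<tau> t)"
      using pos by (simp add: w_def \<gamma>s power_divide)
    \<comment> \<open>Here the weights leave a factor \<open>2\<close> to spare.\<close>
    moreover have "w t * (M * (1 - \<gamma>s t)\<^sup>2) \<le> 3 * M * (\<tau> t - 1)\<^sup>2 / (5 * \<tau> t)"
    proof -
      have "1 - \<gamma>s t = (\<tau> t - 1) / (1 + \<tau> t)" using pos by (simp add: \<gamma>s field_simps)
      then have "w t * (M * (1 - \<gamma>s t)\<^sup>2) = 3 * M * (\<tau> t - 1)\<^sup>2 / (10 * \<tau> t)"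
        using pos by (simp add: w_def power_divide)
      also have "\<dots> \<le> 3 * M * (\<tau> t - 1)\<^sup>2 / (5 * \<tau> t)"
        using pos M by (intro divide_left_mono) auto
      finally show ?thesis .
    qed
    ultimately have "ennreal (w t * (M * (\<gamma>s t)\<^sup>2)) * a t + ennreal (w t * (M * (1 - \<gamma>s t)\<^sup>2)) * b t
      \<le> ennreal (6 * M / (5 * \<tau> t)) * a t + ennreal (3 * M * (\<tau> t - 1)\<^sup>2 / (5 * \<tau> t)) * b t"
      by (intro add_mono mult_right_mono ennreal_leI) auto
    then show ?thesis
      using w0[of t] M by (simp add: ennreal_mult distrib_left mult.assoc)
  qed
  have "(\<integral>\<^sup>+ \<omega>. (\<Sum>t = 1..T. ennreal ((norm (\<epsilon> t \<omega>))\<^sup>2)) \<partial>P) = (\<Sum>t = 1..T. e t)"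
    unfolding e_def using \<epsilon>_meas by (intro nn_integral_sum) measurable
  also have "\<dots> \<le> (\<Sum>t = 1..T. ennreal (w t) * (ennreal (M * (\<gamma>s t)\<^sup>2) * a t + ennreal (M * (1 - \<gamma>s t)\<^sup>2) * b t))"
    by (rule weighted_recursion_sum_le[OF e0 step zero_le_power2 w0 w])
  also have "\<dots> \<le> (\<Sum>t = 1..T. ennreal (6 * M / (5 * \<tau> t)) * a t
      + ennreal (3 * M * (\<tau> t - 1)\<^sup>2 / (5 * \<tau> t)) * b t)"
    by (intro sum_mono coeffs)
  finally show ?thesis by (simp add: sum.distrib a_def b_def)
qed

end
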